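(* Let $d>2$ be an integer, let $\mathcal{C}_d:=\{C:[0,1]^d\to\mathbb{R}:\ C\text{ is a }d\text{-copula}\}$, and let $$\mathcal{M}:=\Bigl\{\boldsymbol{u}\in[0,1]^d:\ u_1\le\dots\le u_d,\ \exists\,\pi\in S_d\ \exists\,C\in\mathcal{C}_d\ \text{such that}\ \lvert C(\boldsymbol{u})-C(\boldsymbol{u}_\pi)\rvert=\tfrac{d-1}{d+1}\Bigr\}.$$ Then $\lvert\mathcal{M}\rvert=1$ if and only if $d=2n+1$ for some $n\in\mathbb{N}$. If $d=2n$, then $\mathcal{M}$ is an $(n-1)$-dimensional manifold.
   Context: A $d$-copula is a function $C:[0,1]^d\to[0,1]$ that is the restriction to $[0,1]^d$ of the joint cumulative distribution function of a random vector $(U_1,\dots,U_d)$ whose components are each uniformly distributed on $[0,1]$. $S_d$ is the group of permutations of $\{1,\dots,d\}$. For $\boldsymbol{u}=(u_1,\dots,u_d)\in[0,1]^d$ and $\pi\in S_d$, $\boldsymbol{u}_\pi:=(u_{\pi(1)},\dots,u_{\pi(d)})$. $\lvert\mathcal{M}\rvert$ denotes the cardinality of $\mathcal{M}$, and $\mathbb{N}=\{1,2,\dots\}$.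
   Formalization: "Manifold" is taken as topological manifold with boundary allowed: for d=2n>2 the set M is a closed (n-1)-simplex (for d=4 a closed segment), so the claim is false for manifolds without boundary. *)

theory Defs
  imports "HOL-Probability.Probability"
begin

section \<open>Copulas\<close>

text \<open>
  Vectors in \<open>\<real>\<^sup>d\<close> are functions on the index set \<open>{1..d}\<close>, extended by \<open>undefined\<close> outside it, so
  that each vector has exactly one representation and cardinalities of sets of vectors are the
  intended ones.
\<close>

definition unit_cube :: "nat \<Rightarrow> (nat \<Rightarrow> real) set" where
  "unit_cube d = {1..d} \<rightarrow>\<^sub>E {0..1}"

text \<open>
  The sample space is taken on the type \<^typ>\<open>nat \<Rightarrow> real\<close>, because an existential quantifier
  cannot range over types. This is no restriction: the law of a random vector of length \<open>d\<close>
  lives on this type, see \<open>copulaI\<close> below.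
\<close>

definition copula :: "nat \<Rightarrow> ((nat \<Rightarrow> real) \<Rightarrow> real) \<Rightarrow> bool" where
  "copula d C \<longleftrightarrow>
     C \<in> unit_cube d \<rightarrow>\<^sub>E {0..1} \<and>
     (\<exists>(M :: (nat \<Rightarrow> real) measure) U.
        prob_space M \<and>
        (\<forall>i\<in>{1..d}. U i \<in> borel_measurable M \<and>
           distr M lborel (U i) = uniform_measure lborel {0..1}) \<and>
        (\<forall>u\<in>unit_cube d. C u = measure M {\<omega> \<in> space M. \<forall>i\<in>{1..d}. U i \<omega> \<le> u i}))"

definition copulas :: "nat \<Rightarrow> ((nat \<Rightarrow> real) \<Rightarrow> real) set" where
  "copulas d = {C. copula d C}"

lemma copulaI:
  fixes M :: "'a measure" and U :: "nat \<Rightarrow> 'a \<Rightarrow> real"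
  assumes "prob_space M"
    and U: "\<And>i. i \<in> {1..d} \<Longrightarrow> U i \<in> borel_measurable M"
    and unif: "\<And>i. i \<in> {1..d} \<Longrightarrow> distr M lborel (U i) = uniform_measure lborel {0..1}"
    and C: "C \<in> extensional (unit_cube d)"
    and cdf: "\<And>u. u \<in> unit_cube d \<Longrightarrow>
                C u = measure M {\<omega> \<in> space M. \<forall>i\<in>{1..d}. U i \<omega> \<le> u i}"
  shows "copula d C"
proof -
  interpret prob_space M by fact
  let ?P = "Pi\<^sub>M {1..d} (\<lambda>_. borel) :: (nat \<Rightarrow> real) measure"
  define V where "V = (\<lambda>\<omega>. \<lambda>i\<in>{1..d}. U i \<omega>)"
  have V[measurable]: "V \<in> measurable M ?P"
    unfolding V_def by (intro measurable_restrict U)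
  define N where "N = distr M ?P V"
  have coord[measurable]: "(\<lambda>x. x i) \<in> borel_measurable ?P" if "i \<in> {1..d}" for i
    using that by measurable
  have 1: "prob_space N"
    unfolding N_def by (intro prob_space_distr V)
  have 2: "(\<lambda>x. x i) \<in> borel_measurable N" if "i \<in> {1..d}" for i
    using coord[OF that] by (simp add: N_def)
  have 3: "distr N lborel (\<lambda>x. x i) = uniform_measure lborel {0..1}" if "i \<in> {1..d}" for i
  proof -
    have "distr N lborel (\<lambda>x. x i) = distr M lborel ((\<lambda>x. x i) \<circ> V)"
      unfolding N_def using coord[OF that] by (intro distr_distr V) simp
    also have "(\<lambda>x. x i) \<circ> V = U i"
      using that by (auto simp: V_def)
    finally show ?thesis using unif[OF that] by simp
  qed
  have 4: "C u = measure N {x \<in> space N. \<forall>i\<in>{1..d}. x i \<le> u i}" if "u \<in> unit_cube d" for u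
  proof -
    have S: "{x \<in> space ?P. \<forall>i\<in>{1..d}. x i \<le> u i} \<in> sets ?P"
      by measurable
    have "measure N {x \<in> space N. \<forall>i\<in>{1..d}. x i \<le> u i} =
          measure M (V -` {x \<in> space ?P. \<forall>i\<in>{1..d}. x i \<le> u i} \<inter> space M)"
      unfolding N_def using measure_distr[OF V S] by simp
    also have "V -` {x \<in> space ?P. \<forall>i\<in>{1..d}. x i \<le> u i} \<inter> space M =
               {\<omega> \<in> space M. \<forall>i\<in>{1..d}. U i \<omega> \<le> u i}"
      using measurable_space[OF V] by (auto simp: V_def)
    finally show ?thesis using cdf[OF that] by simp
  qed
  have "C \<in> unit_cube d \<rightarrow>\<^sub>E {0..1}"
    using C cdf by (auto simp: PiE_def)
  moreover have "\<exists>(M :: (nat \<Rightarrow> real) measure) U.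
        prob_space M \<and>
        (\<forall>i\<in>{1..d}. U i \<in> borel_measurable M \<and>
           distr M lborel (U i) = uniform_measure lborel {0..1}) \<and>
        (\<forall>u\<in>unit_cube d. C u = measure M {\<omega> \<in> space M. \<forall>i\<in>{1..d}. U i \<omega> \<le> u i})"
    using 1 2 3 4 by (intro exI[of _ N] exI[of _ "\<lambda>i x. x i"]) blast
  ultimately show ?thesis unfolding copula_def by blast
qed

text \<open>If \<open>\<pi>\<close> permutes \<open>{1..d}\<close>, then \<open>u \<circ> \<pi>\<close> is the permuted vector \<open>u\<^sub>\<pi>\<close>.\<close>

definition max_asymmetry_points :: "nat \<Rightarrow> (nat \<Rightarrow> real) set" where
  "max_asymmetry_points d =
     {u \<in> unit_cube d. mono_on {1..d} u \<and>
        (\<exists>\<pi>. \<pi> permutes {1..d} \<and>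
           (\<exists>C\<in>copulas d. \<bar>C u - C (u \<circ> \<pi>)\<bar> = (real d - 1) / (real d + 1)))}"


section \<open>Topological manifolds\<close>

text \<open>
  Closed half-space of dimension \<open>m\<close>. Coordinates in \<^const>\<open>Euclidean_space\<close> are numbered from
  \<open>0\<close> and those from \<open>m\<close> on vanish, so for \<open>m = 0\<close> this is the one-point space.
\<close>

definition Euclidean_half_space :: "nat \<Rightarrow> (nat \<Rightarrow> real) topology" where
  "Euclidean_half_space m = subtopology (Euclidean_space m) {x. 0 \<le> x 0}"

text \<open>
  Manifolds are topological manifolds, possibly with boundary. A point with a Euclidean chart also has a
  half-space chart, since Euclidean space is homeomorphic to an open half-space. Nonemptiness
  is required, as the empty space would be a manifold of every dimension.
\<close>

definition manifold_of_dim :: "nat \<Rightarrow> 'a topology \<Rightarrow> bool" where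
  "manifold_of_dim m X \<longleftrightarrow>
     topspace X \<noteq> {} \<and> Hausdorff_space X \<and> second_countable X \<and>
     (\<forall>x\<in>topspace X. \<exists>U V. openin X U \<and> x \<in> U \<and> openin (Euclidean_half_space m) V \<and>
        subtopology X U homeomorphic_space subtopology (Euclidean_half_space m) V)"

end

theory Submission
  imports Defs
begin

text \<open>
  Put \<open>e i = 1 - u i\<close> and \<open>t = (d - 1) / (d + 1)\<close>. If \<open>v\<close> and \<open>w\<close> are permutations of \<open>u\<close>, then
  \<open>C v - C w\<close> is at most \<open>u 1\<close>, at most \<open>u 1 - 1 + \<Sum>i. e i\<close> by the lower Frechet bound, and at most
  the sum of the positive parts of \<open>v i - w i\<close>, hence at most the sum of the distances of the \<open>u i\<close>
  from their median. If all three bounds are at least \<open>t\<close>, they leave a single vector for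
  \<open>d = 2 * n + 1\<close>. For \<open>d = 2 * n\<close> they force \<open>e i = 2 / (d + 1)\<close> for \<open>i \<le> n\<close> and the last \<open>n\<close>
  entries of \<open>e\<close> to be nonnegative and decreasing with sum \<open>1 / (d + 1)\<close>, which describes an
  \<open>(n - 1)\<close>-simplex. All these vectors occur: a discrete random vector whose distribution
  functions take the values \<open>v i\<close> and \<open>w i\<close> at suitable points extends to a copula.
\<close>

section \<open>Copulas of discrete random vectors\<close>

lemma (in prob_space) distr_uniform_unit_intervalI:
  assumes [measurable]: "X \<in> borel_measurable M"
    and cdf: "\<And>t. 0 \<le> t \<Longrightarrow> t \<le> 1 \<Longrightarrow> \<P>(\<omega> in M. X \<omega> \<le> t) = t"
  shows "distr M lborel X = uniform_measure lborel {0..1}"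
proof -
  have "distributed M lborel X (\<lambda>x. indicator {0..1} x / measure lborel {0..1::real})"
    by (rule uniform_distrI_borel_atLeastAtMost) (use cdf in auto)
  then have "distr M lborel X = density lborel (\<lambda>x. ennreal (indicator {0..1} x / measure lborel {0..1::real}))"
    by (rule distributed_distr_eq_density)
  also have "\<dots> = uniform_measure lborel {0..1}"
    unfolding uniform_measure_def
    by (intro density_cong) (auto split: split_indicator)
  finally show ?thesis .
qed

lemma prob_uniform_unit_interval_le:
  assumes "0 \<le> t" "t \<le> 1"
  shows "measure (uniform_measure lborel {0..1::real}) {..t} = t"
  using assms by (subst measure_uniform_measure) (auto simp: Int_atLeastAtMostL2 min_def)

text \<open>The distributional transform: the atom of \<open>J i\<close> at \<open>j\<close> is spread uniformly over the
  interval from \<open>P(J i < j)\<close> to \<open>P(J i \<le> j)\<close>, so that \<open>U i \<le> P(J i \<le> j)\<close> holds if and only if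
  \<open>J i \<le> j\<close>, up to a null set.\<close>

lemma discrete_Sklar:
  fixes p :: "'a pmf" and J :: "nat \<Rightarrow> 'a \<Rightarrow> nat"
  assumes bounded: "\<And>i k. J i k \<le> N"
  obtains C where "copula d C"
    and "\<And>j u. u \<in> unit_cube d \<Longrightarrow> (\<And>i. i \<in> {1..d} \<Longrightarrow> u i = measure_pmf.prob p {k. J i k \<le> j i}) \<Longrightarrow>
           C u = measure_pmf.prob p {k. \<forall>i\<in>{1..d}. J i k \<le> j i}"
proof -
  let ?Y = "uniform_measure lborel {0..1::real}"
  let ?P = "measure_pmf.prob p"
  let ?M = "measure_pmf p \<Otimes>\<^sub>M ?Y"
  define L where "L = (\<lambda>i j. ?P {k. J i k < j})"
  define W where "W = (\<lambda>i j. ?P {k. J i k = j})"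
  \<comment> \<open>One variable \<open>y\<close> spreads the atoms of all coordinates at once. The
    dependence this creates inside the atoms is harmless, since joint probabilities are evaluated
    only for events of the form \<open>J i k \<le> j i\<close>.\<close>
  define U where "U = (\<lambda>i (k, y). L i (J i k) + y * W i (J i k))"
  interpret Y: prob_space ?Y
    by (intro prob_space_uniform_measure) auto
  interpret pair_prob_space "measure_pmf p" ?Y ..
  have U_meas: "U i \<in> borel_measurable ?M" for i
  proof -
    have "(\<lambda>\<omega>. h (fst \<omega>)) \<in> borel_measurable ?M" for h :: "'a \<Rightarrow> real"
      by (rule measurable_compose[OF measurable_fst]) simp
    from this[of "\<lambda>k. L i (J i k)"] this[of "\<lambda>k. W i (J i k)"] show ?thesis
      unfolding U_def split_beta by (intro borel_measurable_add borel_measurable_times) simp_all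
  qed
  have L_Suc: "L i (Suc j) = L i j + W i j" for i j
  proof -
    have "{k. J i k < Suc j} = {k. J i k < j} \<union> {k. J i k = j}" by auto
    then show ?thesis
      unfolding L_def W_def by (simp, intro measure_pmf.finite_measure_Union) auto
  qed
  have L_mono: "L i a \<le> L i b" if "a \<le> b" for i a b
    unfolding L_def using that by (intro measure_pmf.finite_measure_mono) auto
  have W_nonneg: "0 \<le> W i j" for i j
    by (simp add: W_def)
  \<comment> \<open>The exceptional null set: \<open>y = 0\<close> would put \<open>U i\<close> on
    the left end of its interval, and for \<open>k\<close> outside \<open>set_pmf p\<close> that
    interval could be degenerate.\<close>
  have AE_p: "AE \<omega> in ?M. fst \<omega> \<in> set_pmf p \<and> 0 < snd \<omega> \<and> snd \<omega> \<le> 1"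
  proof -
    have "AE y in ?Y. y \<in> {0<..1}"
      by (rule AE_uniform_measureI) (use AE_lborel_singleton[of "0::real"] in \<open>auto elim!: eventually_mono\<close>)
    moreover have "{\<omega> \<in> space ?M. fst \<omega> \<in> set_pmf p \<and> 0 < snd \<omega> \<and> snd \<omega> \<le> 1} = set_pmf p \<times> {0<..1}"
      by (auto simp: space_pair_measure)
    ultimately show ?thesis
      by (intro AE_pair_measure) (auto simp: AE_measure_pmf_iff)
  qed
  have prob_Times: "measure ?M (A \<times> B) = ?P A * measure ?Y B" if "B \<in> sets borel" for A B
    using that by (simp add: measure_def Y.emeasure_pair_measure_Times enn2real_mult)
  have le_iff: "U i \<omega> \<le> L i (Suc j) \<longleftrightarrow> J i (fst \<omega>) \<le> j"
    if "fst \<omega> \<in> set_pmf p" "0 < snd \<omega>" "snd \<omega> \<le> 1" for i j \<omega>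
  proof -
    obtain k y where \<omega>: "\<omega> = (k, y)" by (cases \<omega>)
    have y: "0 < y" "y \<le> 1" and k: "k \<in> set_pmf p" using that \<omega> by auto
    have "0 < W i (J i k)"
      unfolding W_def using k by (auto intro!: measure_pmf_posI)
    then have lo: "L i (J i k) < U i \<omega>" and hi: "U i \<omega> \<le> L i (Suc (J i k))"
      using y by (auto simp: U_def \<omega> L_Suc)
    show ?thesis
      using L_mono[of "Suc j" "J i k" i] L_mono[of "Suc (J i k)" "Suc j" i] lo hi
      by (auto simp: \<omega> not_le[symmetric]) (use not_less_eq_eq in fastforce)+
  qed
  have unif: "distr ?M lborel (U i) = uniform_measure lborel {0..1}" for i
  proof (rule distr_uniform_unit_intervalI[OF U_meas])
    fix t :: real assume t: "0 \<le> t" "t \<le> 1"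
    have L0: "L i 0 = 0" by (simp add: L_def)
    have LN: "L i (Suc N) = 1"
      using bounded by (simp add: L_def less_Suc_eq_le)
    show "measure ?M {\<omega> \<in> space ?M. U i \<omega> \<le> t} = t"
    \<comment> \<open>At \<open>t = 1\<close> no index has a distribution function above
      \<open>t\<close>, so the search for \<open>j\<close> below needs \<open>t < 1\<close>.\<close>
    proof (cases "t = 1")
      case True
      have "AE \<omega> in ?M. U i \<omega> \<le> t"
        using AE_p by (eventually_elim) (use le_iff[of _ i N] bounded LN True in auto)
      then show ?thesis
        using True U_meas[of i] prob_Collect_eq_1[of "\<lambda>\<omega>. U i \<omega> \<le> t"] by simp
    next
      case False
      then have "t < L i (Suc N)" using t LN by simp
      \<comment> \<open>The least such \<open>j\<close> satisfies
        \<open>L i j \<le> t < L i (Suc j)\<close>: it is the atom whose interval contains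
        \<open>t\<close>.\<close>
      then have "\<exists>j. t < L i (Suc j) \<and> (\<forall>j'<j. \<not> t < L i (Suc j'))"
        using exists_least_iff[of "\<lambda>j. t < L i (Suc j)"] by blast
      then obtain j where j: "t < L i (Suc j)" "\<And>j'. j' < j \<Longrightarrow> L i (Suc j') \<le> t"
        by (auto simp: not_less)
      have Lj: "L i j \<le> t"
        using j(2) L0 t(1) by (cases j) auto
      have W: "0 < W i j" using j(1) Lj by (simp add: L_Suc)
      \<comment> \<open>The fraction of the atom at \<open>j\<close> that lies below
        \<open>t\<close>. Up to a null set, \<open>U i \<le> t\<close> means a smaller atom
        (\<open>?A\<close>) or this fraction of atom \<open>j\<close> (\<open>?B\<close>).\<close>
      let ?s = "(t - L i j) / W i j"
      have s: "0 \<le> ?s" "?s \<le> 1" using Lj j(1) W by (auto simp: L_Suc)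
      let ?A = "{k. J i k < j} \<times> (UNIV :: real set)" and ?B = "{k. J i k = j} \<times> {..?s}"
      have "AE \<omega> in ?M. \<omega> \<in> {\<omega> \<in> space ?M. U i \<omega> \<le> t} \<longleftrightarrow> \<omega> \<in> ?A \<union> ?B"
        using AE_p
      proof eventually_elim
        case (elim \<omega>)
        obtain k y where \<omega>: "\<omega> = (k, y)" by (cases \<omega>)
        consider "J i k < j" | "J i k = j" | "j < J i k" by linarith
        then have "U i \<omega> \<le> t \<longleftrightarrow> \<omega> \<in> ?A \<union> ?B"
        proof cases
          case 1
          then show ?thesis using le_iff[of \<omega> i "J i k"] elim j(2)[of "J i k"] by (auto simp: \<omega>)
        next
          case 2
          then show ?thesis using W by (auto simp: \<omega> U_def field_simps)
        next
          case 3
          then show ?thesis using le_iff[of \<omega> i j] elim j(1) by (auto simp: \<omega>)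
        qed
        then show ?case by (simp add: space_pair_measure)
      qed
      then have "measure ?M {\<omega> \<in> space ?M. U i \<omega> \<le> t} = measure ?M (?A \<union> ?B)"
        using U_meas[of i] by (intro measure_eq_AE) auto
      also have "\<dots> = measure ?M ?A + measure ?M ?B"
        by (intro finite_measure_Union) auto
      also have "\<dots> = L i j + W i j * ?s"
        using s Y.prob_space by (simp add: prob_Times prob_uniform_unit_interval_le L_def W_def)
      also have "\<dots> = t" using W by simp
      finally show ?thesis .
    qed
  qed
  define C where "C = (\<lambda>u\<in>unit_cube d. measure ?M {\<omega> \<in> space ?M. \<forall>i\<in>{1..d}. U i \<omega> \<le> u i})"
  show thesis
  proof (rule that)
    show "copula d C"
      by (rule copulaI[OF prob_space_axioms, where U=U]) (use U_meas unif in \<open>auto simp: C_def\<close>)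
    fix j u
    assume u: "u \<in> unit_cube d" and uj: "\<And>i. i \<in> {1..d} \<Longrightarrow> u i = ?P {k. J i k \<le> j i}"
    \<comment> \<open>\<open>L\<close> is defined with a strict inequality, hence the
      \<open>Suc\<close> for the distribution function at \<open>j i\<close>.\<close>
    have uL: "u i = L i (Suc (j i))" if "i \<in> {1..d}" for i
      using uj[OF that] by (simp add: L_def less_Suc_eq_le)
    have "AE \<omega> in ?M. \<omega> \<in> {\<omega> \<in> space ?M. \<forall>i\<in>{1..d}. U i \<omega> \<le> u i} \<longleftrightarrow>
        \<omega> \<in> {k. \<forall>i\<in>{1..d}. J i k \<le> j i} \<times> UNIV"
      using AE_p by eventually_elim (auto simp: uL le_iff space_pair_measure)
    then have "measure ?M {\<omega> \<in> space ?M. \<forall>i\<in>{1..d}. U i \<omega> \<le> u i} =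
        measure ?M ({k. \<forall>i\<in>{1..d}. J i k \<le> j i} \<times> UNIV)"
      using U_meas by (intro measure_eq_AE) (auto intro!: sets.sets_Collect_finite_All borel_measurable_le)
    then show "C u = ?P {k. \<forall>i\<in>{1..d}. J i k \<le> j i}"
      using u Y.prob_space by (simp add: C_def prob_Times)
  qed
qed

lemma pmf_with_finite_weights:
  fixes f :: "'a \<Rightarrow> real"
  assumes "finite S" "\<And>x. x \<in> S \<Longrightarrow> 0 \<le> f x" "sum f S = 1"
  obtains p where "\<And>A. measure_pmf.prob p A = sum f (S \<inter> A)"
proof -
  define g where "g = (\<lambda>x. if x \<in> S then f x else 0)"
  have g: "0 \<le> g x" for x using assms(2) by (simp add: g_def)
  have "(\<integral>\<^sup>+x. ennreal (g x) \<partial>count_space UNIV) = (\<integral>\<^sup>+x. ennreal (f x) \<partial>count_space S)"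
    by (subst nn_integral_count_space_indicator) (auto simp: g_def intro!: nn_integral_cong split: split_indicator)
  also have "\<dots> = 1"
    using assms by (simp add: nn_integral_count_space_finite sum_ennreal)
  finally have 1: "(\<integral>\<^sup>+x. ennreal (g x) \<partial>count_space UNIV) = 1" .
  define p where "p = embed_pmf g"
  have "measure_pmf.prob p A = sum f (S \<inter> A)" for A
  proof -
    have "set_pmf p \<subseteq> S"
      using set_embed_pmf[OF g 1] by (auto simp: p_def g_def split: if_splits)
    then have "measure_pmf.prob p A = measure_pmf.prob p (S \<inter> A)"
      by (intro measure_eq_AE) (auto simp: AE_measure_pmf_iff)
    also have "\<dots> = sum (pmf p) (S \<inter> A)"
      using assms(1) by (simp add: measure_measure_pmf_finite)
    also have "\<dots> = sum f (S \<inter> A)"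
      by (intro sum.cong) (auto simp: p_def pmf_embed_pmf[OF g 1], simp add: g_def)
    finally show ?thesis .
  qed
  then show thesis by (rule that)
qed


section \<open>Bounds on the asymmetry\<close>

text \<open>Each inequality is an inclusion of events or a union bound; the uniform marginals turn
  probabilities of one-coordinate events into lengths.\<close>

lemma copula_bounds:
  assumes C: "copula d C" and v: "v \<in> unit_cube d" and w: "w \<in> unit_cube d"
  shows copula_nonneg: "0 \<le> C v"
    and copula_le_coordinate: "i \<in> {1..d} \<Longrightarrow> C v \<le> v i"
    and copula_Frechet_lower: "1 - (\<Sum>i\<in>{1..d}. 1 - v i) \<le> C v"
    and copula_diff_le: "C v - C w \<le> (\<Sum>i\<in>{1..d}. max 0 (v i - w i))"
proof -
  obtain M :: "(nat \<Rightarrow> real) measure" and U where M: "prob_space M"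
    and U: "\<And>i. i \<in> {1..d} \<Longrightarrow> U i \<in> borel_measurable M"
    and unif: "\<And>i. i \<in> {1..d} \<Longrightarrow> distr M lborel (U i) = uniform_measure lborel {0..1}"
    and Cu: "\<And>u. u \<in> unit_cube d \<Longrightarrow> C u = measure M {\<omega> \<in> space M. \<forall>i\<in>{1..d}. U i \<omega> \<le> u i}"
    using C unfolding copula_def by blast
  interpret prob_space M by fact
  let ?E = "\<lambda>u. {\<omega> \<in> space M. \<forall>i\<in>{1..d}. U i \<omega> \<le> u i}"
  have E[measurable]: "?E u \<in> sets M" for u :: "nat \<Rightarrow> real"
    using U by (intro sets.sets_Collect_finite_All borel_measurable_le) auto
  have Ioc: "prob {\<omega> \<in> space M. U i \<omega> \<in> {a<..b}} = max 0 (b - a)"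
    and Iic: "prob {\<omega> \<in> space M. U i \<omega> \<le> b} = b"
    if i: "i \<in> {1..d}" and ab: "0 \<le> a" "a \<le> 1" "0 \<le> b" "b \<le> 1" for i a b
  proof -
    have *: "prob {\<omega> \<in> space M. U i \<omega> \<in> A} = measure lborel ({0..1} \<inter> A)" if "A \<in> sets borel" for A
    proof -
      have "prob {\<omega> \<in> space M. U i \<omega> \<in> A} = measure (distr M lborel (U i)) A"
        using that U[OF i] by (subst measure_distr) (auto intro!: arg_cong[where f=prob])
      also have "\<dots> = measure lborel ({0..1} \<inter> A)"
        using that unfolding unif[OF i] by (subst measure_uniform_measure) auto
      finally show ?thesis .
    qed
    have "{0..1} \<inter> {a<..b} = {a<..b}" "{0..1} \<inter> {..b} = {0..b}" using ab by auto
    then show "prob {\<omega> \<in> space M. U i \<omega> \<in> {a<..b}} = max 0 (b - a)" "prob {\<omega> \<in> space M. U i \<omega> \<le> b} = b"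
      using *[of "{a<..b}"] *[of "{..b}"] ab by (auto simp: max_def)
  qed
  have in01: "0 \<le> u i" "u i \<le> 1" if "u \<in> unit_cube d" "i \<in> {1..d}" for u i
    using that by (auto simp: unit_cube_def PiE_iff)
  show "0 \<le> C v" by (simp add: Cu[OF v])
  show "C v \<le> v i" if i: "i \<in> {1..d}"
  proof -
    have "C v \<le> prob {\<omega> \<in> space M. U i \<omega> \<le> v i}"
      unfolding Cu[OF v] using U[OF i] i by (intro finite_measure_mono) auto
    then show ?thesis using Iic[OF i] in01[OF v i] by simp
  qed
  have diff: "C u - C w \<le> (\<Sum>i\<in>{1..d}. max 0 (u i - w i))" if u: "u \<in> unit_cube d" for u
  proof -
    let ?D = "\<lambda>i. {\<omega> \<in> space M. U i \<omega> \<in> {w i<..u i}}"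
    have D: "?D i \<in> sets M" if "i \<in> {1..d}" for i
      using U[OF that] by measurable
    then have UD: "(\<Union>i\<in>{1..d}. ?D i) \<in> sets M"
      by (intro sets.finite_UN) auto
    \<comment> \<open>Where \<open>?E u\<close> holds and \<open>?E w\<close> fails, some coordinate
      \<open>i\<close> violates the bound \<open>w i\<close> and so lies in the strip
      \<open>?D i\<close>.\<close>
    have "?E u \<subseteq> ?E w \<union> (\<Union>i\<in>{1..d}. ?D i)" by auto
    then have "C u \<le> prob (?E w \<union> (\<Union>i\<in>{1..d}. ?D i))"
      unfolding Cu[OF u] by (intro finite_measure_mono sets.Un E UD)
    also have "\<dots> \<le> C w + prob (\<Union>i\<in>{1..d}. ?D i)"
      unfolding Cu[OF w] by (intro measure_Un_le E UD)
    also have "prob (\<Union>i\<in>{1..d}. ?D i) \<le> (\<Sum>i\<in>{1..d}. prob (?D i))"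
      using D by (intro finite_measure_subadditive_finite) auto
    also have "\<dots> = (\<Sum>i\<in>{1..d}. max 0 (u i - w i))"
      using in01 u w by (intro sum.cong Ioc) auto
    finally show ?thesis by simp
  qed
  show "C v - C w \<le> (\<Sum>i\<in>{1..d}. max 0 (v i - w i))" by (rule diff[OF v])
  show "1 - (\<Sum>i\<in>{1..d}. 1 - v i) \<le> C v"
  proof -
    have "1 - C v = prob (space M - ?E v)"
      using prob_compl[OF E[of v]] Cu[OF v] by simp
    also have "space M - ?E v = (\<Union>i\<in>{1..d}. {\<omega> \<in> space M. U i \<omega> \<notin> {..v i}})" by auto
    also have "prob \<dots> \<le> (\<Sum>i\<in>{1..d}. prob {\<omega> \<in> space M. U i \<omega> \<notin> {..v i}})"
      using U by (intro finite_measure_subadditive_finite) auto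
    also have "\<dots> = (\<Sum>i\<in>{1..d}. 1 - v i)"
    proof (intro sum.cong refl)
      fix i assume i: "i \<in> {1..d}"
      have "{\<omega> \<in> space M. U i \<omega> \<notin> {..v i}} = space M - {\<omega> \<in> space M. U i \<omega> \<le> v i}" by auto
      then show "prob {\<omega> \<in> space M. U i \<omega> \<notin> {..v i}} = 1 - v i"
        using U[OF i] Iic[OF i] in01[OF v i] by (simp add: prob_compl)
    qed
    finally show ?thesis by simp
  qed
qed

text \<open>Comparing \<open>a\<close> and \<open>b\<close> with \<open>c\<close> separately gives
  \<open>max 0 (a - b) \<le> max 0 (a - c) + max 0 (c - b)\<close>, and the sums on the right do not see the permutation.\<close>

lemma sum_positive_part_permuted_le:
  fixes a :: "'a \<Rightarrow> real"
  assumes "finite S" and "\<pi> permutes S" and "\<rho> permutes S"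
  shows "(\<Sum>i\<in>S. max 0 (a (\<pi> i) - a (\<rho> i))) \<le> (\<Sum>i\<in>S. \<bar>a i - c\<bar>)"
proof -
  have "(\<Sum>i\<in>S. max 0 (a (\<pi> i) - a (\<rho> i))) \<le> (\<Sum>i\<in>S. max 0 (a (\<pi> i) - c) + max 0 (c - a (\<rho> i)))"
    by (intro sum_mono) auto
  also have "\<dots> = (\<Sum>i\<in>S. max 0 (a i - c)) + (\<Sum>i\<in>S. max 0 (c - a i))"
    using sum.permute[OF assms(2), of "\<lambda>i. max 0 (a i - c)"] sum.permute[OF assms(3), of "\<lambda>i. max 0 (c - a i)"]
    by (simp add: sum.distrib o_def)
  also have "\<dots> = (\<Sum>i\<in>S. \<bar>a i - c\<bar>)"
    by (simp add: sum.distrib[symmetric] max_def) (intro sum.cong; auto)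
  finally show ?thesis .
qed

lemma permuted_unit_cube:
  assumes "u \<in> unit_cube d" "\<pi> permutes {1..d}"
  shows "u \<circ> \<pi> \<in> unit_cube d"
  using assms permutes_in_image[OF assms(2)] permutes_not_in[OF assms(2)]
  by (auto simp: unit_cube_def PiE_iff extensional_def)

text \<open>The vectors \<open>u\<close> and \<open>u \<circ> \<pi>\<close> have the same entries,
  so both copula values have the ceiling \<open>u i\<close> and the same floors, namely
  \<open>0\<close> and the lower Frechet bound. The first two estimates are ceiling minus floor. The
  third applies the positive-part bound in both orders; its free \<open>c\<close> will be taken as a
  median.\<close>

lemma copula_permuted_diff_bounds:
  assumes C: "copula d C" and u: "u \<in> unit_cube d"
    and \<pi>: "\<pi> permutes {1..d}" and i: "i \<in> {1..d}"
  shows "\<bar>C u - C (u \<circ> \<pi>)\<bar> \<le> u i"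
    and "\<bar>C u - C (u \<circ> \<pi>)\<bar> \<le> u i - 1 + (\<Sum>j\<in>{1..d}. 1 - u j)"
    and "\<bar>C u - C (u \<circ> \<pi>)\<bar> \<le> (\<Sum>j\<in>{1..d}. \<bar>u j - c\<bar>)"
proof -
  let ?v = "u \<circ> \<pi>"
  have v: "?v \<in> unit_cube d" by (rule permuted_unit_cube[OF u \<pi>])
  \<comment> \<open>Entry \<open>inv \<pi> i\<close> of the permuted vector is
    \<open>u i\<close>.\<close>
  have "C ?v \<le> ?v (inv \<pi> i)"
    using permutes_in_image[OF permutes_inv[OF \<pi>]] i by (intro copula_le_coordinate[OF C v v]) auto
  then have up: "C u \<le> u i" "C ?v \<le> u i"
    using copula_le_coordinate[OF C u u i] permutes_inverses(1)[OF \<pi>] by auto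
  have nonneg: "0 \<le> C u" "0 \<le> C ?v"
    using copula_nonneg[OF C u u] copula_nonneg[OF C v v] by auto
  then show "\<bar>C u - C ?v\<bar> \<le> u i" using up by linarith
  have "(\<Sum>j\<in>{1..d}. 1 - ?v j) = (\<Sum>j\<in>{1..d}. 1 - u j)"
    using sum.permute[OF \<pi>, of "\<lambda>j. 1 - u j"] by (simp add: o_def)
  then show "\<bar>C u - C ?v\<bar> \<le> u i - 1 + (\<Sum>j\<in>{1..d}. 1 - u j)"
    using up copula_Frechet_lower[OF C u u] copula_Frechet_lower[OF C v v] by linarith
  have "C u - C ?v \<le> (\<Sum>j\<in>{1..d}. \<bar>u j - c\<bar>)"
    using copula_diff_le[OF C u v] sum_positive_part_permuted_le[OF _ permutes_id \<pi>, of u c] by simp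
  moreover have "C ?v - C u \<le> (\<Sum>j\<in>{1..d}. \<bar>u j - c\<bar>)"
    using copula_diff_le[OF C v u] sum_positive_part_permuted_le[OF _ \<pi> permutes_id, of u c] by simp
  ultimately show "\<bar>C u - C ?v\<bar> \<le> (\<Sum>j\<in>{1..d}. \<bar>u j - c\<bar>)" by linarith
qed

section \<open>Rigidity: equality cases of the three bounds\<close>

lemma max_asymmetry_points_bounds:
  assumes "u \<in> max_asymmetry_points d" and "i \<in> {1..d}"
  shows "(real d - 1) / (real d + 1) \<le> u i"
    and "(real d - 1) / (real d + 1) \<le> u i - 1 + (\<Sum>j\<in>{1..d}. 1 - u j)"
    and "(real d - 1) / (real d + 1) \<le> (\<Sum>j\<in>{1..d}. \<bar>u j - c\<bar>)"
proof -
  obtain \<pi> C where "u \<in> unit_cube d" "\<pi> permutes {1..d}" "copula d C"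
    and "\<bar>C u - C (u \<circ> \<pi>)\<bar> = (real d - 1) / (real d + 1)"
    using assms(1) by (auto simp: max_asymmetry_points_def copulas_def)
  then show "(real d - 1) / (real d + 1) \<le> u i"
    and "(real d - 1) / (real d + 1) \<le> u i - 1 + (\<Sum>j\<in>{1..d}. 1 - u j)"
    and "(real d - 1) / (real d + 1) \<le> (\<Sum>j\<in>{1..d}. \<bar>u j - c\<bar>)"
    using copula_permuted_diff_bounds[of d C u \<pi> i] assms(2) by auto
qed

text \<open>Turns a bound that is attained in total into equalities for single coordinates.\<close>

lemma sum_ge_upper_bound_imp_eq:
  fixes f g :: "'a \<Rightarrow> real"
  assumes "finite S" "\<And>i. i \<in> S \<Longrightarrow> f i \<le> g i" "sum g S \<le> sum f S" "i \<in> S"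
  shows "f i = g i"
proof -
  have "sum f S = sum g S" using assms sum_mono[of S f g] by force
  then show ?thesis
    using sum_mono_inv[of f S g i] assms by auto
qed

text \<open>The required asymmetry is \<open>n * ?h = 1 - ?h\<close>. The first bound puts every
  entry between \<open>1 - ?h\<close> and \<open>1\<close>, the third makes \<open>n\<close> gaps of
  size at most \<open>?h\<close> add up to at least \<open>n * ?h\<close>, and so every gap is full.
  Only the median entry is then open, and the second bound settles it.\<close>

lemma max_asymmetry_points_odd_cases:
  assumes n: "1 \<le> n" and u: "u \<in> max_asymmetry_points (2 * n + 1)"
  shows "i \<in> {1..n + 1} \<Longrightarrow> u i = 1 - 1 / (real n + 1)"
    and "i \<in> {n + 2..2 * n + 1} \<Longrightarrow> u i = 1"
proof -
  let ?d = "2 * n + 1" and ?h = "1 / (real n + 1)"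
  have cube: "u i \<le> 1" if "i \<in> {1..?d}" for i
    using that u by (auto simp: max_asymmetry_points_def unit_cube_def PiE_iff)
  have mono: "u i \<le> u j" if "i \<le> j" "i \<in> {1..?d}" "j \<in> {1..?d}" for i j
    using u that unfolding max_asymmetry_points_def by (blast intro: mono_onD)
  have t: "(real ?d - 1) / (real ?d + 1) = real n * ?h" "1 - ?h = real n * ?h"
    by (auto simp: field_simps)
  note bounds = max_asymmetry_points_bounds[OF u, unfolded t(1)]
  have lower: "1 - ?h \<le> u i" if "i \<in> {1..?d}" for i
    using bounds(1)[OF that] t(2) by simp
  have split: "{1..?d} = {1..n} \<union> {n + 1} \<union> {n + 2..?d}" by auto
  have sum_split: "sum f {1..?d} = sum f {1..n} + f (n + 1) + sum f {n + 2..?d}" for f :: "nat \<Rightarrow> real"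
    unfolding split by (subst sum.union_disjoint, auto)+
  have shift: "sum f {n + 2..?d} = (\<Sum>i\<in>{1..n}. f (i + (n + 1)))" for f :: "nat \<Rightarrow> real"
    using sum.shift_bounds_cl_nat_ivl[of f 1 "n + 1" n] by (simp add: add.commute add.left_commute mult_2)
  \<comment> \<open>With \<open>c\<close> the median entry \<open>u (n + 1)\<close>, the median
    drops out, and by monotonicity the pair \<open>i\<close>, \<open>i + (n + 1)\<close> contributes
    its gap.\<close>
  have "(\<Sum>i\<in>{1..n}. ?h) \<le> (\<Sum>j\<in>{1..?d}. \<bar>u j - u (n + 1)\<bar>)"
    using bounds(3)[of 1 "u (n + 1)"] by simp
  also have "\<dots> = (\<Sum>i\<in>{1..n}. \<bar>u i - u (n + 1)\<bar> + \<bar>u (i + (n + 1)) - u (n + 1)\<bar>)"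
    unfolding sum_split shift sum.distrib by simp
  also have "\<dots> = (\<Sum>i\<in>{1..n}. u (i + (n + 1)) - u i)"
    using mono by (intro sum.cong) (auto simp: abs_if not_less intro: antisym)
  finally have gaps: "(\<Sum>i\<in>{1..n}. ?h) \<le> (\<Sum>i\<in>{1..n}. u (i + (n + 1)) - u i)" .
  have gap_le: "u (i + (n + 1)) - u i \<le> ?h" if "i \<in> {1..n}" for i
  proof -
    have "1 - ?h \<le> u i" "u (i + (n + 1)) \<le> 1"
      using that by (intro lower cube; simp)+
    then show ?thesis by linarith
  qed
  have eq: "u i = 1 - ?h" "u (i + (n + 1)) = 1" if "i \<in> {1..n}" for i
  proof -
    have "u (i + (n + 1)) - u i = ?h"
      by (rule sum_ge_upper_bound_imp_eq[OF _ gap_le gaps that]) simp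
    moreover have "1 - ?h \<le> u i" "u (i + (n + 1)) \<le> 1"
      using that by (intro lower cube; simp)+
    ultimately show "u i = 1 - ?h" "u (i + (n + 1)) = 1" by linarith+
  qed
  \<comment> \<open>At the smallest entry the second bound contains \<open>u (n + 1)\<close> as its
    only remaining unknown and bounds it above by \<open>1 - ?h\<close>.\<close>
  have "real n * ?h \<le> u 1 - 1 + (\<Sum>j\<in>{1..?d}. 1 - u j)"
    by (rule bounds(2)) simp
  also have "(\<Sum>j\<in>{1..?d}. 1 - u j) = real n * ?h + (1 - u (n + 1))"
    unfolding sum_split shift by (simp add: eq del: One_nat_def)
  finally have "u (n + 1) = 1 - ?h"
    using lower[of "n + 1"] eq(1)[of 1] n by simp
  then show "u i = 1 - ?h" if "i \<in> {1..n + 1}"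
    using that eq(1)[of i] by (cases "i = n + 1") auto
  show "u i = 1" if "i \<in> {n + 2..?d}"
    using that eq(2)[of "i - (n + 1)"] by force
qed

text \<open>Let \<open>?T\<close> and \<open>?B\<close> be the sums of \<open>1 - u i\<close> over
  the lower and upper half. The third bound controls \<open>?T - ?B\<close> from below, the second
  \<open>?T + ?B\<close>. Together with \<open>1 - u i \<le> 2 * h\<close> from the first, they
  determine \<open>u 1\<close>, then \<open>?T\<close> at its maximum \<open>n * (2 * h)\<close>,
  hence the lower half, and finally \<open>?B\<close>.\<close>

lemma max_asymmetry_points_even_cases:
  assumes n: "1 \<le> n" and u: "u \<in> max_asymmetry_points (2 * n)"
  shows "i \<in> {1..n} \<Longrightarrow> u i = 1 - 2 / (2 * real n + 1)"
    and "(\<Sum>i\<in>{1..n}. 1 - u (i + n)) = 1 / (2 * real n + 1)"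
proof -
  let ?d = "2 * n"
  define h where "h = 1 / (2 * real n + 1)"
  have h: "0 < h" by (simp add: h_def)
  have cube: "u i \<le> 1" if "i \<in> {1..?d}" for i
    using that u by (auto simp: max_asymmetry_points_def unit_cube_def PiE_iff)
  have mono: "u i \<le> u j" if "i \<le> j" "i \<in> {1..?d}" "j \<in> {1..?d}" for i j
    using u that unfolding max_asymmetry_points_def by (blast intro: mono_onD)
  have t: "(real ?d - 1) / (real ?d + 1) = 1 - 2 * h" "real n * (2 * h) = 1 - h"
    by (auto simp: h_def field_simps)
  note bounds = max_asymmetry_points_bounds[OF u, unfolded t(1)]
  have sum_split: "sum f {1..?d} = sum f {1..n} + (\<Sum>i\<in>{1..n}. f (i + n))" for f :: "nat \<Rightarrow> real"
  proof -
    have "{1..?d} = {1..n} \<union> {n + 1..?d}" by auto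
    then have "sum f {1..?d} = sum f {1..n} + sum f {n + 1..?d}"
      by (simp add: sum.union_disjoint)
    then show ?thesis
      using sum.shift_bounds_cl_nat_ivl[of f 1 n n] by (simp add: add.commute mult_2)
  qed
  let ?T = "\<Sum>i\<in>{1..n}. 1 - u i" and ?B = "\<Sum>i\<in>{1..n}. 1 - u (i + n)"
  \<comment> \<open>\<open>u n\<close> is a median, so each pair \<open>i\<close>,
    \<open>i + n\<close> contributes its gap \<open>u (i + n) - u i\<close>.\<close>
  have "1 - 2 * h \<le> (\<Sum>j\<in>{1..?d}. \<bar>u j - u n\<bar>)"
    using bounds(3)[of 1 "u n"] n by simp
  also have "\<dots> = (\<Sum>i\<in>{1..n}. \<bar>u i - u n\<bar> + \<bar>u (i + n) - u n\<bar>)"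
    unfolding sum_split sum.distrib by simp
  also have "\<dots> = (\<Sum>i\<in>{1..n}. (1 - u i) - (1 - u (i + n)))"
    using mono by (intro sum.cong) (auto simp: abs_if not_less intro: antisym)
  also have "\<dots> = ?T - ?B" by (rule sum_subtractf)
  finally have TB: "1 - 2 * h \<le> ?T - ?B" .
  have "1 - 2 * h \<le> u 1 - 1 + (\<Sum>j\<in>{1..?d}. 1 - u j)"
    using n by (intro bounds(2)) simp
  then have TB': "1 - 2 * h + (1 - u 1) \<le> ?T + ?B" by (simp only: sum_split)
  have T1: "?T \<le> real n * (1 - u 1)"
    using mono sum_mono[of "{1..n}" "\<lambda>i. 1 - u i" "\<lambda>i. 1 - u 1"] by simp
  \<comment> \<open>Adding \<open>TB\<close> and \<open>TB'\<close> eliminates \<open>?B\<close>;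
    inserting \<open>T1\<close> leaves \<open>2 * (1 - 2 * h) \<le> (2 * n - 1) * (1 - u 1)\<close>,
    and \<open>1 - 2 * h = (2 * n - 1) * h\<close>.\<close>
  have "(2 * real n - 1) * (2 * h) \<le> (2 * real n - 1) * (1 - u 1)"
    using TB TB' T1 t(2) by (simp add: algebra_simps)
  then have "2 * h \<le> 1 - u 1"
    using n by (subst (asm) mult_le_cancel_left_pos) auto
  moreover have lower: "1 - u i \<le> 2 * h" if "i \<in> {1..?d}" for i
    using bounds(1)[OF that] by simp
  ultimately have u1: "1 - u 1 = 2 * h" using lower[of 1] n by force
  have T: "?T = 1 - h"
    using T1 TB TB' u1 t(2) by simp
  show "u i = 1 - 2 / (2 * real n + 1)" if "i \<in> {1..n}"
  proof -
    have "1 - u i = 2 * h"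
      by (rule sum_ge_upper_bound_imp_eq[where S="{1..n}" and g="\<lambda>_. 2 * h"])
        (use lower T t(2) that in auto)
    then show ?thesis by (simp add: h_def)
  qed
  show "?B = 1 / (2 * real n + 1)"
    using TB TB' T u1 by (simp add: h_def)
qed


section \<open>Vectors of maximal asymmetry\<close>

text \<open>The extremal permutation: \<open>s = n + 1\<close> exchanges the blocks on both sides of
  a fixed median index, \<open>s = n\<close> exchanges the two halves in even dimension.\<close>

definition block_swap :: "nat \<Rightarrow> nat \<Rightarrow> nat \<Rightarrow> nat" where
  "block_swap n s i = (if i \<in> {1..n} then i + s else if i \<in> {s + 1..s + n} then i - s else i)"

lemma block_swap_permutes:
  assumes "n \<le> s"
  shows "block_swap n s permutes {1..s + n}"
proof -
  have "block_swap n s (block_swap n s i) = i" for i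
    using assms by (auto simp: block_swap_def)
  then have "bij_betw (block_swap n s) {1..s + n} {1..s + n}"
    using assms by (intro bij_betwI[where g="block_swap n s"]) (auto simp: block_swap_def)
  then show ?thesis
    using assms by (intro bij_imp_permutes) (auto simp: block_swap_def)
qed

text \<open>Reduces membership to a finite computation: the thresholds \<open>j\<close> and
  \<open>j'\<close> represent \<open>u\<close> and its permutation on the marginals, and
  \<open>discrete_Sklar\<close> turns the joint probabilities into copula values. The permuted
  vector receives the larger value.\<close>

lemma max_asymmetry_pointsI:
  fixes p :: "'a pmf" and J :: "nat \<Rightarrow> 'a \<Rightarrow> nat"
  assumes bounded: "\<And>i k. J i k \<le> N"
    and u: "u \<in> unit_cube d" "mono_on {1..d} u" and \<pi>: "\<pi> permutes {1..d}"
    and j: "\<And>i. i \<in> {1..d} \<Longrightarrow> u i = measure_pmf.prob p {k. J i k \<le> j i}"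
    and j': "\<And>i. i \<in> {1..d} \<Longrightarrow> u (\<pi> i) = measure_pmf.prob p {k. J i k \<le> j' i}"
    and diff: "measure_pmf.prob p {k. \<forall>i\<in>{1..d}. J i k \<le> j' i} -
        measure_pmf.prob p {k. \<forall>i\<in>{1..d}. J i k \<le> j i} = (real d - 1) / (real d + 1)"
    and d: "1 \<le> d"
  shows "u \<in> max_asymmetry_points d"
proof (rule discrete_Sklar[where J=J and p=p and d=d, OF bounded])
  fix C
  assume C: "copula d C"
    and Cu: "\<And>j u. u \<in> unit_cube d \<Longrightarrow> (\<And>i. i \<in> {1..d} \<Longrightarrow> u i = measure_pmf.prob p {k. J i k \<le> j i}) \<Longrightarrow>
           C u = measure_pmf.prob p {k. \<forall>i\<in>{1..d}. J i k \<le> j i}"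
  have "C (u \<circ> \<pi>) - C u = (real d - 1) / (real d + 1)"
    using Cu[OF u(1) j] Cu[OF permuted_unit_cube[OF u(1) \<pi>], of j'] j' diff by simp
  moreover have "0 \<le> (real d - 1) / (real d + 1)"
    using d by simp
  ultimately have "\<bar>C u - C (u \<circ> \<pi>)\<bar> = (real d - 1) / (real d + 1)" by linarith
  then show ?thesis
    using u \<pi> C unfolding max_asymmetry_points_def copulas_def by blast
qed

text \<open>For attainment, \<open>n + 1\<close> equally likely atoms suffice: the joint event of
  \<open>?u\<close> misses all of them, that of the permuted vector misses only atom
  \<open>0\<close>.\<close>

lemma max_asymmetry_points_odd:
  assumes "1 \<le> n"
  shows "max_asymmetry_points (2 * n + 1) =
    {\<lambda>i\<in>{1..2 * n + 1}. if i \<le> n + 1 then 1 - 1 / (real n + 1) else 1}"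
    (is "_ = {?u}")
proof (rule antisym)
  show "max_asymmetry_points (2 * n + 1) \<subseteq> {?u}"
  proof
    fix u assume u: "u \<in> max_asymmetry_points (2 * n + 1)"
    then have "u \<in> extensional {1..2 * n + 1}"
      by (auto simp: max_asymmetry_points_def unit_cube_def PiE_def)
    then have "u = ?u"
      using max_asymmetry_points_odd_cases[OF assms u] by (intro extensionalityI) auto
    then show "u \<in> {?u}" by simp
  qed
  let ?h = "1 / (real n + 1)" and ?S = "{0..n}"
  \<comment> \<open>Coordinate \<open>i \<le> n\<close> singles out atom \<open>i\<close>; all later
    coordinates single out atom \<open>0\<close>. Threshold \<open>0\<close> excludes the chosen
    atom and threshold \<open>1\<close> excludes nothing.\<close>
  define J :: "nat \<Rightarrow> nat \<Rightarrow> nat"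
    where "J = (\<lambda>i k. if k = (if i \<le> n then i else 0) then 1 else 0)"
  have h: "0 < ?h" "real n * ?h = 1 - ?h" by (auto simp: field_simps)
  obtain p where p: "\<And>A. measure_pmf.prob p A = (\<Sum>k\<in>?S \<inter> A. ?h)"
    by (rule pmf_with_finite_weights[of ?S "\<lambda>_. ?h"]) (use h in auto)
  have le1: "measure_pmf.prob p {k. J i k \<le> 1} = 1" for i
    using h(2) by (simp add: p J_def algebra_simps)
  have le0: "measure_pmf.prob p {k. J i k \<le> 0} = 1 - ?h" for i
  proof -
    have "?S \<inter> {k. J i k \<le> 0} = ?S - {if i \<le> n then i else 0}" by (auto simp: J_def)
    then show ?thesis using h(2) by (simp add: p)
  qed
  have "k \<noteq> 0 \<longleftrightarrow> (\<forall>i\<in>{1..2 * n + 1}. J i k \<le> (if i \<le> n then 1 else 0))" for k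
  proof
    assume "\<forall>i\<in>{1..2 * n + 1}. J i k \<le> (if i \<le> n then 1 else 0)"
    then have "J (n + 1) k \<le> (if n + 1 \<le> n then 1 else 0)" by (rule bspec) simp
    then show "k \<noteq> 0" by (auto simp: J_def split: if_splits)
  qed (simp add: J_def)
  then have "?S \<inter> {k. \<forall>i\<in>{1..2 * n + 1}. J i k \<le> (if i \<le> n then 1 else 0)} = ?S \<inter> {k. k \<noteq> 0}"
    by simp
  also have "\<dots> = {1..n}" by auto
  finally have "?S \<inter> {k. \<forall>i\<in>{1..2 * n + 1}. J i k \<le> (if i \<le> n then 1 else 0)} = {1..n}" .
  then have j': "measure_pmf.prob p {k. \<forall>i\<in>{1..2 * n + 1}. J i k \<le> (if i \<le> n then 1 else 0)} = 1 - ?h"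
    using h(2) by (simp add: p)
  \<comment> \<open>Atom \<open>0\<close> is excluded by coordinate \<open>n + 1\<close>, every
    other atom \<open>k\<close> by coordinate \<open>k\<close>.\<close>
  have "\<exists>i\<in>{1..2 * n + 1}. \<not> J i k \<le> (if i \<le> n + 1 then 0 else 1)" if "k \<in> ?S" for k
    using that by (intro bexI[of _ "if k = 0 then n + 1 else k"]) (auto simp: J_def)
  then have "?S \<inter> {k. \<forall>i\<in>{1..2 * n + 1}. J i k \<le> (if i \<le> n + 1 then 0 else 1)} = {}"
    by blast
  then have j: "measure_pmf.prob p {k. \<forall>i\<in>{1..2 * n + 1}. J i k \<le> (if i \<le> n + 1 then 0 else 1)} = 0"
    by (simp add: p)
  have "?u \<in> max_asymmetry_points (2 * n + 1)"
  proof (rule max_asymmetry_pointsI)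
    show "J i k \<le> 1" for i k by (simp add: J_def)
    show "?u \<in> unit_cube (2 * n + 1)"
      by (auto simp: unit_cube_def)
    show "mono_on {1..2 * n + 1} ?u"
      using h by (auto intro!: mono_onI)
    show \<pi>: "block_swap n (n + 1) permutes {1..2 * n + 1}"
      using block_swap_permutes[of n "n + 1"] by (simp add: mult_2 add.commute)
    show "?u i = measure_pmf.prob p {k. J i k \<le> (if i \<le> n + 1 then 0 else 1)}"
      if "i \<in> {1..2 * n + 1}" for i
      using that le0 le1 by auto
    show "?u (block_swap n (n + 1) i) = measure_pmf.prob p {k. J i k \<le> (if i \<le> n then 1 else 0)}"
      if i: "i \<in> {1..2 * n + 1}" for i
      using permutes_in_image[OF \<pi>, of i] i le0[of i] le1[of i] by (auto simp: block_swap_def)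
    show "measure_pmf.prob p {k. \<forall>i\<in>{1..2 * n + 1}. J i k \<le> (if i \<le> n then 1 else 0)} -
      measure_pmf.prob p {k. \<forall>i\<in>{1..2 * n + 1}. J i k \<le> (if i \<le> n + 1 then 0 else 1)} =
      (real (2 * n + 1) - 1) / (real (2 * n + 1) + 1)"
      unfolding j j' by (simp add: field_simps)
  qed simp
  then show "{?u} \<subseteq> max_asymmetry_points (2 * n + 1)" by simp
qed

text \<open>For attainment, each \<open>k \<le> n\<close> gets three atoms, with
  \<open>c = 0, 1, 2\<close>. The joint event of \<open>u\<close> is empty, that of the permuted
  vector consists of the atoms with \<open>c = 0\<close>.\<close>

lemma max_asymmetry_points_even:
  assumes n: "1 \<le> n"
  shows "max_asymmetry_points (2 * n) =
    {u \<in> extensional {1..2 * n}. mono_on {1..2 * n} u \<and>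
       (\<forall>i\<in>{1..n}. u i = 1 - 2 / (2 * real n + 1)) \<and> (\<forall>i\<in>{1..n}. u (i + n) \<le> 1) \<and>
       (\<Sum>i\<in>{1..n}. 1 - u (i + n)) = 1 / (2 * real n + 1)}"
    (is "_ = ?R")
proof (rule antisym)
  show "max_asymmetry_points (2 * n) \<subseteq> ?R"
  proof
    fix u assume u: "u \<in> max_asymmetry_points (2 * n)"
    then have "u \<in> extensional {1..2 * n}" "mono_on {1..2 * n} u" "\<forall>i\<in>{1..n}. u (i + n) \<le> 1"
      by (auto simp: max_asymmetry_points_def unit_cube_def PiE_def Pi_iff)
    then show "u \<in> ?R"
      using max_asymmetry_points_even_cases[OF n u] by auto
  qed
  show "?R \<subseteq> max_asymmetry_points (2 * n)"
  proof
    fix u assume uR: "u \<in> ?R"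
    define h where "h = 1 / (2 * real n + 1)"
    define e where "e = (\<lambda>k. 1 - u (k + n))"
    have h: "0 < h" "real n * (2 * h) = 1 - h" by (auto simp: h_def field_simps)
    have h1: "2 * h \<le> 1" using n by (simp add: h_def field_simps)
    have u1: "u i = 1 - 2 * h" if "i \<in> {1..n}" for i using uR that by (simp add: h_def)
    have e0: "0 \<le> e k" if "k \<in> {1..n}" for k using uR that by (simp add: e_def)
    have esum: "(\<Sum>k\<in>{1..n}. e k) = h" using uR by (simp add: h_def e_def)
    \<comment> \<open>Keeps the weight \<open>2 * h - e k\<close> below nonnegative.\<close>
    have eh: "e k \<le> h" if "k \<in> {1..n}" for k
      using member_le_sum[of k "{1..n}" e] that e0 esum by auto
    let ?S = "{1..n} \<times> {0, 1, 2::nat}"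
    \<comment> \<open>The three weights for \<open>k\<close> add up to \<open>2 * h + e k\<close>,
      so the total is \<open>n * (2 * h) + h = 1\<close>.\<close>
    define f where "f = (\<lambda>(k, c::nat). if c = 0 then 2 * h - e k else e k)"
    have S: "sum f ?S = 1"
      using h(2) esum by (simp add: sum.cartesian_product[symmetric] f_def sum.distrib sum_subtractf)
    have f0: "0 \<le> f x" if "x \<in> ?S" for x
      using that e0 eh h(1) by (fastforce simp: f_def)
    obtain p where p: "\<And>A. measure_pmf.prob p A = sum f (?S \<inter> A)"
      by (rule pmf_with_finite_weights[of ?S f]) (use S f0 in auto)
    \<comment> \<open>Each coordinate needs both marginal levels. For \<open>i \<le> n\<close>,
      level above \<open>0\<close> has mass \<open>2 * h\<close> (\<open>c = 0, 1\<close> at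
      \<open>k = i\<close>) and level \<open>2\<close> has mass \<open>e i\<close>. For
      \<open>i > n\<close>, level above \<open>0\<close> is \<open>c \<noteq> 0\<close>, of mass
      \<open>2 * h\<close> in total, and level \<open>2\<close> is one atom of mass
      \<open>e (i - n)\<close>.\<close>
    define J :: "nat \<Rightarrow> nat \<times> nat \<Rightarrow> nat"
      where "J = (\<lambda>i (k, c). if i \<le> n then (if k \<noteq> i \<or> c = 2 then 0 else if c = 0 then 1 else 2)
                        else if c = 0 then 0 else if c = 2 \<and> i = k + n then 2 else 1)"
    have compl: "measure_pmf.prob p A = 1 - sum f B" if "?S \<inter> A = ?S - B" "B \<subseteq> ?S" for A B
      unfolding p that(1) using S that(2) by (subst sum_diff) auto
    have lo0: "measure_pmf.prob p {k. J i k \<le> 0} = 1 - 2 * h" if "i \<in> {1..n}" for i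
      by (subst compl[where B="{(i, 0), (i, 1)}"]) (use that in \<open>auto simp: J_def f_def split: if_splits\<close>)
    have lo1: "measure_pmf.prob p {k. J i k \<le> 1} = 1 - e i" if "i \<in> {1..n}" for i
      by (subst compl[where B="{(i, 1)}"]) (use that in \<open>auto simp: J_def f_def split: if_splits\<close>)
    have hi0: "measure_pmf.prob p {k. J i k \<le> 0} = 1 - 2 * h" if "i \<in> {n + 1..2 * n}" for i
    proof (subst compl[where B="{1..n} \<times> {1, 2}"])
      show "1 - sum f ({1..n} \<times> {1, 2}) = 1 - 2 * h"
        using esum by (simp add: sum.cartesian_product[symmetric] f_def sum.distrib sum_distrib_left[symmetric])
    qed (use that in \<open>auto simp: J_def split: if_splits\<close>)
    have hi1: "measure_pmf.prob p {k. J i k \<le> 1} = u i" if "i \<in> {n + 1..2 * n}" for i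
      by (subst compl[where B="{(i - n, 2)}"]) (use that in \<open>auto simp: J_def f_def e_def split: if_splits\<close>)
    have "?S \<inter> {k. \<forall>i\<in>{1..2 * n}. J i k \<le> (if i \<le> n then 1 else 0)} = {1..n} \<times> {0}"
      (is "?S \<inter> ?A = _")
    proof (rule antisym)
      have c0: "c = 0" if "(k, c) \<in> ?S \<inter> ?A" for k c
      proof (rule ccontr)
        assume c: "c \<noteq> 0"
        \<comment> \<open>An atom with \<open>c = 1\<close> exceeds threshold \<open>1\<close> at
          the lower coordinate \<open>k\<close>, one with \<open>c = 2\<close> exceeds threshold
          \<open>0\<close> at the upper coordinate \<open>k + n\<close>.\<close>
        let ?i = "if c = 1 then k else k + n"
        have k: "k \<in> {1..n}" "c \<in> {1, 2}" using that c by auto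
        then have "\<not> J ?i (k, c) \<le> (if ?i \<le> n then 1 else 0)"
          by (auto simp: J_def)
        moreover have "?i \<in> {1..2 * n}" using k by auto
        ultimately show False using that by blast
      qed
      show "?S \<inter> ?A \<subseteq> {1..n} \<times> {0}"
      proof (rule subrelI)
        fix k c assume kc: "(k, c) \<in> ?S \<inter> ?A"
        then have "k \<in> {1..n}" by (simp only: Int_iff mem_Sigma_iff)
        then show "(k, c) \<in> {1..n} \<times> {0}" using c0[OF kc] by simp
      qed
    qed (auto simp: J_def)
    then have j': "measure_pmf.prob p ?A = 1 - 2 * h"
      using h(2) esum by (simp add: p sum.cartesian_product[symmetric] f_def sum_subtractf)
    have "?S \<inter> {k. \<forall>i\<in>{1..2 * n}. J i k \<le> (if i \<le> n then 0 else 1)} = {}"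
      (is "?S \<inter> ?B = _")
    proof -
      have "(k, c) \<notin> ?B" if "k \<in> {1..n}" "c \<in> {0, 1, 2}" for k c
      proof
        assume B: "(k, c) \<in> ?B"
        \<comment> \<open>Atoms with \<open>c = 0\<close> or \<open>c = 1\<close> are excluded by
          coordinate \<open>k\<close>, those with \<open>c = 2\<close> by
          \<open>k + n\<close>.\<close>
        let ?i = "if c = 2 then k + n else k"
        have "?i \<in> {1..2 * n}" using that by auto
        then have "J ?i (k, c) \<le> (if ?i \<le> n then 0 else 1)" using B by blast
        then show False using that by (auto simp: J_def split: if_splits)
      qed
      then show ?thesis by blast
    qed
    then have j: "measure_pmf.prob p ?B = 0" by (simp add: p)
    show "u \<in> max_asymmetry_points (2 * n)"
    proof (rule max_asymmetry_pointsI)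
      show "J i k \<le> 2" for i k by (simp add: J_def split_beta)
      show "u \<in> unit_cube (2 * n)"
      proof -
        have "u i \<in> {0..1}" if "i \<in> {1..2 * n}" for i
        proof (cases "i \<le> n")
          case True
          then show ?thesis using u1[of i] that h h1 by auto
        next
          case False
          then have "i - n \<in> {1..n}" "i - n + n = i" using that by auto
          then show ?thesis
            using e0[of "i - n"] eh[of "i - n"] h h1 by (auto simp: e_def)
        qed
        then show ?thesis using uR by (auto simp: unit_cube_def PiE_def)
      qed
      show "mono_on {1..2 * n} u" using uR by simp
      show \<pi>: "block_swap n n permutes {1..2 * n}"
        using block_swap_permutes[of n n] by (simp add: mult_2)
      show "u i = measure_pmf.prob p {k. J i k \<le> (if i \<le> n then 0 else 1)}"
        if "i \<in> {1..2 * n}" for i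
        using that lo0[of i] hi1[of i] u1[of i] by auto
      show "u (block_swap n n i) = measure_pmf.prob p {k. J i k \<le> (if i \<le> n then 1 else 0)}"
        if "i \<in> {1..2 * n}" for i
      proof (cases "i \<le> n")
        case True
        then show ?thesis using that lo1[of i] by (simp add: block_swap_def e_def)
      next
        case False
        then have "i - n \<in> {1..n}" using that by auto
        then show ?thesis using that False hi0[of i] u1[of "i - n"] by (simp add: block_swap_def)
      qed
      show "measure_pmf.prob p ?A - measure_pmf.prob p ?B = (real (2 * n) - 1) / (real (2 * n) + 1)"
        unfolding j j' by (simp add: h_def field_simps)
    qed (use n in simp)
  qed
qed


section \<open>Simplices as manifolds with boundary\<close>

lemma manifold_of_dim_homeomorphic:
  assumes "manifold_of_dim m Y" and "X homeomorphic_space Y"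
  shows "manifold_of_dim m X"
proof -
  obtain f where f: "homeomorphic_map X Y f"
    using assms(2) homeomorphic_space by blast
  then have fm: "open_map X Y f" "continuous_map X Y f" and fX: "f ` topspace X = topspace Y"
    by (auto simp: homeomorphic_eq_everything_map)
  have "\<exists>U V. openin X U \<and> x \<in> U \<and> openin (Euclidean_half_space m) V \<and>
        subtopology X U homeomorphic_space subtopology (Euclidean_half_space m) V"
    if x: "x \<in> topspace X" for x
  proof -
    have "f x \<in> topspace Y" using x fX by auto
    then obtain U V where U: "openin Y U" "f x \<in> U" and V: "openin (Euclidean_half_space m) V"
      and UV: "subtopology Y U homeomorphic_space subtopology (Euclidean_half_space m) V"
      using assms(1) unfolding manifold_of_dim_def by blast
    let ?W = "{x \<in> topspace X. f x \<in> U}"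
    have W: "openin X ?W"
      using fm(2) U(1) by (simp add: openin_continuous_map_preimage)
    have "subtopology X ?W homeomorphic_space subtopology Y U"
      by (rule homeomorphic_map_imp_homeomorphic_space, rule homeomorphic_map_subtopologies_alt[OF f]) auto
    then show ?thesis
      using W x U(2) V homeomorphic_space_trans[OF _ UV] by blast
  qed
  moreover have "topspace X \<noteq> {}"
    using assms(1) fX unfolding manifold_of_dim_def by (metis image_is_empty)
  moreover have "Hausdorff_space X"
    using assms homeomorphic_Hausdorff_space by (auto simp: manifold_of_dim_def)
  moreover have "second_countable X"
    using assms homeomorphic_space_second_countability by (auto simp: manifold_of_dim_def)
  ultimately show ?thesis
    by (simp add: manifold_of_dim_def)
qed

text \<open>Local model of a simplex near a vertex, padded with zeros in the layout of
  \<open>Euclidean_space\<close>.\<close>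

definition orthant :: "nat \<Rightarrow> (nat \<Rightarrow> real) set" where
  "orthant m = {x. (\<forall>i. 0 \<le> x i) \<and> (\<forall>i\<ge>m. x i = 0)}"

text \<open>The standard simplex with \<open>n\<close> vertices in barycentric coordinates, so its
  dimension is \<open>n - 1\<close>.\<close>

definition prob_simplex :: "nat \<Rightarrow> (nat \<Rightarrow> real) set" where
  "prob_simplex n = {x. (\<forall>i. 0 \<le> x i) \<and> (\<forall>i\<ge>n. x i = 0) \<and> (\<Sum>i<n. x i) = 1}"

lemma INF_add_const_right:
  fixes f :: "'a \<Rightarrow> real"
  assumes "finite S" "S \<noteq> {}"
  shows "(INF j\<in>S. f j + c) = (INF j\<in>S. f j) + c"
  using assms Min_add_commute[OF assms, of f c] by (simp add: cInf_eq_Min)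

lemma continuous_map_powertop_coordinate:
  "continuous_map (subtopology (powertop_real UNIV) S) euclideanreal (\<lambda>x. x i)"
  by (intro continuous_map_from_subtopology continuous_map_product_projection) simp

text \<open>The diagonal direction becomes the half-line; the boundary of the orthant projects along it
  onto a hyperplane.\<close>

lemma orthant_homeomorphic_half_space:
  assumes "0 < m"
  shows "subtopology (powertop_real UNIV) (orthant m) homeomorphic_space Euclidean_half_space m"
proof -
  \<comment> \<open>Slot \<open>0\<close> of a half-space point stores the half-line coordinate;
    \<open>r\<close> clears it to obtain a representative with zeroth entry
    \<open>0\<close>.\<close>
  define r where "r = (\<lambda>(s::nat\<Rightarrow>real) i. if i = 0 then 0 else s i)"
  \<comment> \<open>The minimum measures the distance to the boundary along the diagonal; the
    differences to \<open>x 0\<close> do not change along it.\<close>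
  define f where "f = (\<lambda>(x::nat\<Rightarrow>real) i. if i = 0 then (INF j\<in>{..<m}. x j)
                        else if i < m then x i - x 0 else 0)"
  \<comment> \<open>Shifts \<open>r s\<close> along the diagonal until its minimum equals
    \<open>s 0\<close>.\<close>
  define g where "g = (\<lambda>s i. if i < m then (r s i + s 0) - (INF j\<in>{..<m}. r s j) else 0)"
  have ne: "{..<m} \<noteq> {}" using assms by auto
  have H: "Euclidean_half_space m = subtopology (powertop_real UNIV) {x. 0 \<le> x 0 \<and> (\<forall>i\<ge>m. x i = 0)}"
    by (auto simp: Euclidean_half_space_def Euclidean_space_def subtopology_subtopology
        intro!: arg_cong[where f="subtopology _"])
  note c = continuous_map_powertop_coordinate
  have INF_le: "(INF j\<in>{..<m}. h j) \<le> h i" if "i < m" for h :: "nat \<Rightarrow> real" and i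
    using that by (intro cINF_lower) auto
  have fo: "f x \<in> {x. 0 \<le> x 0 \<and> (\<forall>i\<ge>m. x i = 0)}" if "x \<in> orthant m" for x
    using that assms ne by (auto simp: f_def orthant_def intro!: cINF_greatest)
  have go: "g s \<in> orthant m" if "0 \<le> s 0" for s
    using that INF_le[of _ "r s"] by (auto simp: g_def orthant_def)
      (metis add.commute add_increasing2 add_mono diff_ge_0_iff_ge le_diff_eq add.right_neutral)
  have gf: "g (f x) = x" if "x \<in> orthant m" for x
  proof
    fix i
    have "(INF j\<in>{..<m}. r (f x) j) = (INF j\<in>{..<m}. x j + - x 0)"
      by (intro INF_cong) (auto simp: r_def f_def)
    also have "\<dots> = (INF j\<in>{..<m}. x j) - x 0"
      using INF_add_const_right[OF _ ne, of x "- x 0"] by simp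
    finally show "g (f x) i = x i"
      using that by (auto simp: g_def f_def r_def orthant_def)
  qed
  have fg: "f (g s) = s" if "\<forall>i\<ge>m. s i = 0" for s
  proof
    fix i
    have "(INF j\<in>{..<m}. g s j) = (INF j\<in>{..<m}. r s j + (s 0 - (INF j\<in>{..<m}. r s j)))"
      by (intro INF_cong) (auto simp: g_def)
    also have "\<dots> = s 0"
      using INF_add_const_right[OF _ ne, of "r s" "s 0 - (INF j\<in>{..<m}. r s j)"] by simp
    finally show "f (g s) i = s i"
      using that assms by (auto simp: f_def) (auto simp: g_def r_def)
  qed
  have "homeomorphic_maps (subtopology (powertop_real UNIV) (orthant m)) (Euclidean_half_space m) f g"
    unfolding homeomorphic_maps_def
  proof (intro conjI)
    have "continuous_map (subtopology (powertop_real UNIV) (orthant m)) euclideanreal (\<lambda>x. f x i)" for i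
      unfolding f_def by (cases "i = 0"; cases "i < m"; simp; intro continuous_intros c) auto
    then show "continuous_map (subtopology (powertop_real UNIV) (orthant m)) (Euclidean_half_space m) f"
      using fo by (auto simp: H continuous_map_in_subtopology continuous_map_componentwise_UNIV)
    have r: "continuous_map (Euclidean_half_space m) euclideanreal (\<lambda>s. r s i)" for i
      unfolding r_def H by (cases "i = 0"; simp add: c)
    have "continuous_map (Euclidean_half_space m) euclideanreal (\<lambda>s. g s i)" for i
      unfolding g_def by (cases "i < m"; simp; intro continuous_intros r) (auto simp: H c)
    then show "continuous_map (Euclidean_half_space m) (subtopology (powertop_real UNIV) (orthant m)) g"
      using go by (auto simp: H continuous_map_in_subtopology continuous_map_componentwise_UNIV)
  qed (use gf fg in \<open>auto simp: H\<close>)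
  then show ?thesis
    unfolding homeomorphic_space_def by blast
qed

text \<open>Projective coordinates: the ratios to the positive entry \<open>x k\<close> are
  arbitrary nonnegative numbers, and normalising the total to \<open>1\<close> recovers
  \<open>x\<close>.\<close>

lemma prob_simplex_chart:
  assumes k: "k < n"
  shows "subtopology (powertop_real UNIV) {x \<in> prob_simplex n. 0 < x k} homeomorphic_space
         subtopology (powertop_real UNIV) (orthant (n - 1))"
proof -
  let ?m = "n - 1"
  \<comment> \<open>Moves \<open>k\<close> to the last position, so that the other indices are
    numbered by \<open>{..<n - 1}\<close>.\<close>
  define \<sigma> where "\<sigma> = Transposition.transpose k ?m"
  have \<sigma>\<sigma>[simp]: "\<sigma> (\<sigma> i) = i" for i by (simp add: \<sigma>_def)
  have \<sigma>k[simp]: "\<sigma> k = ?m" "\<sigma> ?m = k" by (simp_all add: \<sigma>_def)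
  have \<sigma>n: "\<sigma> i < n \<longleftrightarrow> i < n" for i
    using k by (auto simp: \<sigma>_def Transposition.transpose_def)
  have \<sigma>m: "\<sigma> i < ?m" if "i < n" "i \<noteq> k" for i
    using that k by (auto simp: \<sigma>_def Transposition.transpose_def)
  have \<sigma>nk: "\<sigma> i \<noteq> k" if "i < ?m" for i
    using that \<sigma>\<sigma>[of i] by (metis \<sigma>k(1) nat_neq_iff)
  have bij: "bij_betw \<sigma> ({..<n} - {k}) {..<?m}"
    by (rule bij_betwI[where g=\<sigma>]) (use \<sigma>m \<sigma>n \<sigma>nk k in auto)
  define f where "f = (\<lambda>x j. if j < ?m then x (\<sigma> j) / x k else 0 :: real)"
  define g where "g = (\<lambda>y i. (if i = k then 1 else if i < n then y (\<sigma> i) else 0) / (1 + (\<Sum>j<?m. y j)) :: real)"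
  let ?S = "{x \<in> prob_simplex n. 0 < x k}"
  have pos: "0 < 1 + (\<Sum>j<?m. y j)" if "y \<in> orthant ?m" for y
    using that by (auto simp: orthant_def intro!: add_pos_nonneg sum_nonneg)
  have fo: "f x \<in> orthant ?m" if "x \<in> ?S" for x
    using that by (auto simp: f_def orthant_def prob_simplex_def)
  have split: "(\<Sum>i<n. h i) = h k + (\<Sum>j<?m. h (\<sigma> j))" for h :: "nat \<Rightarrow> real"
  proof -
    have "(\<Sum>i<n. h i) = h k + (\<Sum>i\<in>{..<n} - {k}. h i)"
      using k by (intro sum.remove) auto
    also have "(\<Sum>i\<in>{..<n} - {k}. h i) = (\<Sum>i\<in>{..<n} - {k}. h (\<sigma> (\<sigma> i)))" by simp
    also have "\<dots> = (\<Sum>j<?m. h (\<sigma> j))"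
      using sum.reindex_bij_betw[OF bij, of "\<lambda>j. h (\<sigma> j)"] .
    finally show ?thesis .
  qed
  have go: "g y \<in> ?S" if y: "y \<in> orthant ?m" for y
  proof -
    have "(\<Sum>j<?m. g y (\<sigma> j)) = (\<Sum>j<?m. y j) / (1 + (\<Sum>j<?m. y j))"
      unfolding sum_divide_distrib using \<sigma>nk \<sigma>n by (intro sum.cong) (auto simp: g_def)
    then have "(\<Sum>i<n. g y i) = 1"
      using pos[OF y] split[of "g y"] by (simp add: g_def add_divide_distrib[symmetric])
    then show ?thesis
      using y pos[OF y] k by (auto simp: g_def prob_simplex_def orthant_def)
  qed
  have gf: "g (f x) = x" if x: "x \<in> ?S" for x
  proof
    fix i
    have "1 = x k + (\<Sum>j<?m. x (\<sigma> j))"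
      using split[of x] x by (auto simp: prob_simplex_def)
    then have eq: "1 + (\<Sum>j<?m. f x j) = 1 / x k"
      using x by (simp add: f_def sum_divide_distrib[symmetric] field_simps)
    show "g (f x) i = x i"
      using x \<sigma>m[of i] unfolding g_def eq by (auto simp: f_def prob_simplex_def)
  qed
  have fg: "f (g y) = y" if y: "y \<in> orthant ?m" for y
  proof
    fix i
    show "f (g y) i = y i"
      using pos[OF y] y \<sigma>nk[of i] \<sigma>n[of i] k by (auto simp: f_def g_def orthant_def)
  qed
  have "homeomorphic_maps (subtopology (powertop_real UNIV) ?S)
     (subtopology (powertop_real UNIV) (orthant ?m)) f g"
    unfolding homeomorphic_maps_def
  proof (intro conjI)
    have "continuous_map (subtopology (powertop_real UNIV) ?S) euclideanreal (\<lambda>x. f x i)" for i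
      unfolding f_def
      by (cases "i < ?m"; simp; intro continuous_intros continuous_map_powertop_coordinate) auto
    then show "continuous_map (subtopology (powertop_real UNIV) ?S)
      (subtopology (powertop_real UNIV) (orthant ?m)) f"
      using fo by (auto simp: continuous_map_in_subtopology continuous_map_componentwise_UNIV)
    have c: "continuous_map (subtopology (powertop_real UNIV) (orthant ?m)) euclideanreal
       (\<lambda>y. if i = k then 1 else if i < n then y (\<sigma> i) else 0)" for i
      by (cases "i = k"; cases "i < n"; simp add: continuous_map_powertop_coordinate)
    have "continuous_map (subtopology (powertop_real UNIV) (orthant ?m)) euclideanreal (\<lambda>y. g y i)" for i
      unfolding g_def
      by (intro continuous_intros continuous_map_powertop_coordinate c) (use pos in force)+
    then show "continuous_map (subtopology (powertop_real UNIV) (orthant ?m))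
      (subtopology (powertop_real UNIV) ?S) g"
      using go by (auto simp: continuous_map_in_subtopology continuous_map_componentwise_UNIV)
  qed (use gf fg in auto)
  then show ?thesis
    unfolding homeomorphic_space_def by blast
qed

text \<open>Entries summing to \<open>1\<close> cannot all vanish, so the charts at positive entries
  cover the simplex. Each of them is an orthant of positive dimension and hence homeomorphic to the
  whole half-space.\<close>

lemma manifold_prob_simplex:
  assumes "2 \<le> n"
  shows "manifold_of_dim (n - 1) (subtopology (powertop_real UNIV) (prob_simplex n))"
  unfolding manifold_of_dim_def
proof (intro conjI ballI)
  let ?X = "subtopology (powertop_real UNIV) (prob_simplex n)"
  let ?H = "Euclidean_half_space (n - 1)"
  have "(\<lambda>i. if i = 0 then 1 else 0) \<in> prob_simplex n"
    using assms by (auto simp: prob_simplex_def)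
  then show "topspace ?X \<noteq> {}" by auto
  show "Hausdorff_space ?X"
    by (intro Hausdorff_space_subtopology) (simp add: Hausdorff_space_product_topology)
  \<comment> \<open>The countable basis comes from the type class;
    \<open>euclidean_product_topology\<close> identifies the two topologies.\<close>
  have "second_countable (euclidean :: (nat \<Rightarrow> real) topology)"
    unfolding second_countable_def using ex_countable_basis
    by (metis open_openin topological_basisE topological_basis_open)
  then show "second_countable ?X"
    by (intro second_countable_subtopology) (simp add: euclidean_product_topology)
  fix x assume "x \<in> topspace ?X"
  then have x: "x \<in> prob_simplex n" by simp
  have "\<exists>k<n. 0 < x k"
  proof (rule ccontr)
    assume "\<not> ?thesis"
    then have "(\<Sum>i<n. x i) \<le> 0" by (intro sum_nonpos) auto
    then show False using x by (simp add: prob_simplex_def)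
  qed
  then obtain k where k: "k < n" "0 < x k" by blast
  let ?U = "{x \<in> prob_simplex n. 0 < x k}"
  have U: "openin ?X ?U"
    using openin_continuous_map_preimage[OF continuous_map_powertop_coordinate[of "prob_simplex n" k], of "{0<..}"]
    by simp
  have "subtopology ?X ?U = subtopology (powertop_real UNIV) ?U"
    by (auto simp: subtopology_subtopology intro!: arg_cong[where f="subtopology _"])
  moreover have "subtopology (powertop_real UNIV) ?U homeomorphic_space ?H"
    using homeomorphic_space_trans[OF prob_simplex_chart[OF k(1)] orthant_homeomorphic_half_space] assms
    by simp
  ultimately show "\<exists>U V. openin ?X U \<and> x \<in> U \<and> openin ?H V \<and>
        subtopology ?X U homeomorphic_space subtopology ?H V"
    using U x k(2) by (intro exI[of _ ?U] exI[of _ "topspace ?H"]) auto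
qed


section \<open>The even-dimensional case\<close>

text \<open>Abel summation; the boundary term disappears for sequences with
  \<open>e m = 0\<close>.\<close>

lemma sum_weighted_differences:
  fixes e :: "nat \<Rightarrow> real"
  shows "(\<Sum>j<m. real (j + 1) * (e j - e (j + 1))) = (\<Sum>j<m. e j) - real m * e m"
  by (induction m) (auto simp: algebra_simps)

text \<open>In terms of \<open>e l = 1 - u (n + 1 + l)\<close> for \<open>l < n\<close> and \<open>e n = 0\<close>, the barycentric coordinates
  are the scaled gaps \<open>(j + 1) * (e j - e (j + 1))\<close>: they are nonnegative since \<open>e\<close> decreases,
  and they add up to \<open>e 0 + \<dots> + e (n - 1)\<close>.\<close>

lemma max_asymmetry_points_even_homeomorphic:
  assumes n: "1 \<le> n"
  shows "subtopology (powertop_real {1..2 * n}) (max_asymmetry_points (2 * n)) homeomorphic_space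
    subtopology (powertop_real UNIV) (prob_simplex n)"
proof -
  define h where "h = 1 / (2 * real n + 1)"
  have h: "0 < h" by (simp add: h_def)
  define e where "e = (\<lambda>u l. if l < n then 1 - u (n + 1 + l) else (0 :: real))"
  define f where "f = (\<lambda>u j. if j < n then real (j + 1) * (e u j - e u (j + 1)) / h else 0)"
  \<comment> \<open>Undoes \<open>f\<close>: the tail sum of the gaps
    \<open>h * x j / (j + 1)\<close> telescopes back to the entry \<open>l\<close> of
    \<open>e\<close>.\<close>
  define E where "E = (\<lambda>x l. h * (\<Sum>j\<in>{l..<n}. x j / real (j + 1)))"
  define g where "g = (\<lambda>x. \<lambda>i\<in>{1..2 * n}. if i \<le> n then 1 - 2 * h else 1 - E x (i - (n + 1)))"
  let ?M = "{u \<in> extensional {1..2 * n}. mono_on {1..2 * n} u \<and>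
       (\<forall>i\<in>{1..n}. u i = 1 - 2 * h) \<and> (\<forall>i\<in>{1..n}. u (i + n) \<le> 1) \<and>
       (\<Sum>i\<in>{1..n}. 1 - u (i + n)) = h}"
  have M: "max_asymmetry_points (2 * n) = ?M"
    using max_asymmetry_points_even[OF n] by (simp add: h_def)
  have sum_e: "(\<Sum>i\<in>{1..n}. 1 - u (i + n)) = (\<Sum>l<n. e u l)" for u :: "nat \<Rightarrow> real"
    using sum.atLeast1_atMost_eq[of "\<lambda>i. 1 - u (i + n)" n] by (simp add: e_def add.commute)
  have fo: "f u \<in> prob_simplex n" if u: "u \<in> ?M" for u
  proof -
    have "0 \<le> f u j" for j
    proof (cases "j < n")
      case True
      have "e u (j + 1) \<le> e u j"
      proof (cases "j + 1 < n")
        case True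
        have "u (n + 1 + j) \<le> u (n + 1 + (j + 1))"
          using u True by (intro mono_onD[of "{1..2 * n}" u]) auto
        then show ?thesis using True by (simp add: e_def)
      next
        case False
        \<comment> \<open>The last gap compares with the default value \<open>e u n = 0\<close>, so
          it is nonnegative because \<open>u (2 * n) \<le> 1\<close>.\<close>
        have "\<forall>i\<in>{1..n}. u (i + n) \<le> 1" using u by blast
        then have "u (j + 1 + n) \<le> 1"
          by (rule bspec) (use \<open>j < n\<close> in simp)
        then show ?thesis using False \<open>j < n\<close> by (simp add: e_def add.commute)
      qed
      then show ?thesis using h by (simp add: f_def)
    qed (simp add: f_def)
    moreover have "(\<Sum>j<n. f u j) = (\<Sum>j<n. real (j + 1) * (e u j - e u (j + 1))) / h"
      unfolding sum_divide_distrib by (intro sum.cong) (auto simp: f_def)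
    then have "(\<Sum>j<n. f u j) = (\<Sum>l<n. e u l) / h"
      unfolding sum_weighted_differences by (simp add: e_def)
    then have "(\<Sum>j<n. f u j) = 1"
      using u h sum_e[of u] by simp
    ultimately show ?thesis
      by (auto simp: prob_simplex_def f_def)
  qed
  have E_diff: "real (l + 1) * (E x l - E x (l + 1)) = h * x l" if "l < n" for x l
  proof -
    have "E x l - E x (l + 1) = h * (x l / real (l + 1))"
      using that by (simp add: E_def sum.atLeast_Suc_lessThan algebra_simps)
    then show ?thesis by simp
  qed
  have En: "E x l = 0" if "n \<le> l" for x l
    using that by (simp add: E_def)
  have e_g: "e (g x) l = E x l" for x l
    using En by (auto simp: e_def g_def)
  have fg: "f (g x) = x" if x: "x \<in> prob_simplex n" for x
  proof
    fix j
    show "f (g x) j = x j"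
      using x E_diff[of j x] h unfolding f_def e_g by (auto simp: prob_simplex_def)
  qed
  have E_f: "E (f u) l = e u l" if "l \<le> n" for u l
  proof -
    have "E (f u) l = (\<Sum>j\<in>{l..<n}. e u j - e u (Suc j))"
      unfolding E_def sum_distrib_left using h by (intro sum.cong) (auto simp: f_def)
    also have "\<dots> = - (\<Sum>j\<in>{l..<n}. e u (Suc j) - e u j)"
      by (simp add: sum_negf[symmetric])
    also have "\<dots> = e u l - e u n"
      using that by (simp add: sum_Suc_diff')
    finally show ?thesis by (simp add: e_def)
  qed
  have gf: "g (f u) = u" if u: "u \<in> ?M" for u
  proof (rule extensionalityI[of _ "{1..2 * n}"])
    fix i assume i: "i \<in> {1..2 * n}"
    show "g (f u) i = u i"
      using i u by (cases "i \<le> n") (auto simp: g_def E_f e_def)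
  qed (use u in \<open>auto simp: g_def\<close>)
  have go: "g x \<in> ?M" if x: "x \<in> prob_simplex n" for x
  proof -
    have x0: "0 \<le> x j" for j using x by (simp add: prob_simplex_def)
    have E0: "0 \<le> E x l" for l
      using h x0 by (auto simp: E_def intro!: mult_nonneg_nonneg sum_nonneg)
    have E_mono: "E x b \<le> E x a" if "a \<le> b" for a b
      unfolding E_def using h x0 that by (intro mult_left_mono sum_mono2) auto
    have sum_E: "(\<Sum>l<n. E x l) = h"
    proof -
      have "(\<Sum>j<n. real (j + 1) * (E x j - E x (j + 1))) = (\<Sum>j<n. h * x j)"
        by (intro sum.cong refl E_diff) simp
      then show ?thesis
        using x unfolding sum_weighted_differences
        by (simp add: En sum_distrib_left[symmetric] prob_simplex_def)
    qed
    \<comment> \<open>Monotonicity of \<open>g x\<close> needs this where the constant block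
      \<open>1 - 2 * h\<close> meets the upper block.\<close>
    have "E x l \<le> 2 * h" for l
    proof (cases "l < n")
      case True
      then show ?thesis
        using member_le_sum[of l "{..<n}" "E x"] E0 sum_E h by auto
    qed (use En h in auto)
    then have "mono_on {1..2 * n} (g x)"
      using E_mono by (intro mono_onI) (auto simp: g_def)
    then show ?thesis
      using E0 sum_E sum_e[of "g x"] unfolding e_g by (simp, simp add: g_def)
  qed
  let ?X = "subtopology (powertop_real {1..2 * n}) ?M"
  let ?Y = "subtopology (powertop_real UNIV) (prob_simplex n)"
  have "homeomorphic_maps ?X ?Y f g"
    unfolding homeomorphic_maps_def
  proof (intro conjI)
    have coord: "continuous_map ?X euclideanreal (\<lambda>u. u i)" if "i \<in> {1..2 * n}" for i
      using that by (intro continuous_map_from_subtopology continuous_map_product_projection)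
    have "continuous_map ?X euclideanreal (\<lambda>u. e u l)" for l
      unfolding e_def by (cases "l < n"; simp; intro continuous_intros coord) auto
    then have "continuous_map ?X euclideanreal (\<lambda>u. f u j)" for j
      unfolding f_def using h by (cases "j < n"; simp; intro continuous_intros) auto
    then show "continuous_map ?X ?Y f"
      using fo by (auto simp: continuous_map_in_subtopology continuous_map_componentwise_UNIV)
    have "continuous_map ?Y euclideanreal (\<lambda>x. E x l)" for l
      unfolding E_def by (intro continuous_intros continuous_map_powertop_coordinate) auto
    then have "continuous_map ?Y euclideanreal (\<lambda>x. g x i)" if "i \<in> {1..2 * n}" for i
      unfolding g_def using that by (cases "i \<le> n"; simp; intro continuous_intros) auto
    then show "continuous_map ?Y ?X g"
      using go by (auto simp: continuous_map_in_subtopology continuous_map_componentwise)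
  qed (use gf fg in auto)
  then show ?thesis
    unfolding M homeomorphic_space_def by blast
qed

section \<open>Counting points and assembling both claims\<close>

lemma card_prob_simplex:
  assumes "2 \<le> n"
  shows "card (prob_simplex n) \<noteq> 1"
proof
  assume "card (prob_simplex n) = 1"
  then obtain a where a: "prob_simplex n = {a}" by (rule card_1_singletonE)
  \<comment> \<open>These are the vertices; the ones for \<open>k = 0\<close> and
    \<open>k = 1\<close> already differ.\<close>
  have "(\<lambda>i. if i = k then 1 else 0) \<in> prob_simplex n" if "k < n" for k
    using that by (auto simp: prob_simplex_def)
  from this[of 0] this[of 1]
  have "(\<lambda>i::nat. if i = 0 then 1 else 0 :: real) = (\<lambda>i. if i = 1 then 1 else 0)"
    using assms unfolding a by auto
  then show False by (metis zero_neq_one)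
qed

theorem lemma4p2:
  fixes d :: nat
  assumes "d > 2"
  shows "(card (max_asymmetry_points d) = 1 \<longleftrightarrow> (\<exists>n\<ge>1. d = 2 * n + 1)) \<and>
         (\<forall>n. d = 2 * n \<longrightarrow>
            manifold_of_dim (n - 1)
              (subtopology (powertop_real {1..d}) (max_asymmetry_points d)))"
proof (intro conjI iffI allI impI)
  assume card: "card (max_asymmetry_points d) = 1"
  show "\<exists>n\<ge>1. d = 2 * n + 1"
  proof (cases "even d")
    case True
    then obtain n where n: "d = 2 * n" by blast
    let ?X = "subtopology (powertop_real {1..d}) (max_asymmetry_points d)"
    obtain f where "homeomorphic_map ?X (subtopology (powertop_real UNIV) (prob_simplex n)) f"
      using max_asymmetry_points_even_homeomorphic[of n] assms unfolding n homeomorphic_space by auto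
    then have "bij_betw f (topspace ?X) (prob_simplex n)"
      by (auto simp: homeomorphic_eq_everything_map bij_betw_def)
    \<comment> \<open>The vectors are extensional, so the carrier of \<open>?X\<close> is the whole
      set and the homeomorphism transfers its cardinality to the simplex.\<close>
    moreover have "max_asymmetry_points d \<subseteq> topspace (powertop_real {1..d})"
      by (auto simp: max_asymmetry_points_def unit_cube_def PiE_def)
    then have "topspace ?X = max_asymmetry_points d" by (auto simp del: topspace_product_topology)
    ultimately have "card (prob_simplex n) = 1"
      using card bij_betw_same_card by metis
    then show ?thesis
      using card_prob_simplex[of n] n assms by simp
  next
    case False
    then show ?thesis using assms by (auto elim!: oddE)
  qed
next
  assume "\<exists>n\<ge>1. d = 2 * n + 1"
  then show "card (max_asymmetry_points d) = 1"
    using max_asymmetry_points_odd by force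
next
  fix n assume n: "d = 2 * n"
  show "manifold_of_dim (n - 1) (subtopology (powertop_real {1..d}) (max_asymmetry_points d))"
    unfolding n
    by (rule manifold_of_dim_homeomorphic[OF manifold_prob_simplex max_asymmetry_points_even_homeomorphic])
      (use assms n in auto)
qed

end
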